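(* For integers $s,t\ge 4$, $$r_{pot}(K_s,K_{1,t-1})=\begin{cases}2s, & \text{if } t<s+2,\\ t+s-2, & \text{otherwise.}\end{cases}$$
   Context: All graphs are finite and simple. A sequence of nonnegative integers $\pi=(d_1,\dots,d_n)$ (written in nonincreasing order) is graphic if some graph of order $n$ has degree sequence $\pi$; such a graph is a realization of $\pi$. For a graph $H$, a graphic sequence $\pi$ is potentially $H$-graphic if some realization of $\pi$ contains $H$ as a subgraph. For an $N$-term graphic sequence $\pi=(d_1,\dots,d_N)$, its complementary sequence is $\overline{\pi}=(N-1-d_N,\dots,N-1-d_1)$. For graphs $H_1,H_2$, the potential-Ramsey number $r_{pot}(H_1,H_2)$ is the minimum integer $N$ such that for every $N$-term graphic sequence $\pi$, either $\pi$ is potentially $H_1$-graphic or $\overline{\pi}$ is potentially $H_2$-graphic. $K_s$ is the complete graph on $s$ vertices and $K_{1,t-1}$ is the star with $t-1$ leaves. *)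

theory Defs
  imports Main
begin

text \<open>A graph of order N is a symmetric irreflexive relation on the vertex set {0..<N}.
  A (finite simple) pattern graph H is a pair (number of vertices n, adjacency on {0..<n}).\<close>

type_synonym sgraph = "nat \<Rightarrow> nat \<Rightarrow> bool"

definition is_graph :: "nat \<Rightarrow> sgraph \<Rightarrow> bool" where
  "is_graph N G \<longleftrightarrow>
     (\<forall>i j. G i j \<longrightarrow> i < N \<and> j < N) \<and>
     (\<forall>i. \<not> G i i) \<and>
     (\<forall>i j. G i j \<longrightarrow> G j i)"

definition degree :: "nat \<Rightarrow> sgraph \<Rightarrow> nat \<Rightarrow> nat" where
  "degree N G i = card {j. j < N \<and> G i j}"

definition realizes :: "sgraph \<Rightarrow> nat list \<Rightarrow> bool" where
  "realizes G \<pi> \<longleftrightarrow> is_graph (length \<pi>) G \<and>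
     (\<forall>i < length \<pi>. degree (length \<pi>) G i = \<pi> ! i)"

definition graphic :: "nat list \<Rightarrow> bool" where
  "graphic \<pi> \<longleftrightarrow> (\<exists>G. realizes G \<pi>)"

definition contains_subgraph :: "nat \<Rightarrow> sgraph \<Rightarrow> nat \<times> sgraph \<Rightarrow> bool" where
  "contains_subgraph N G H \<longleftrightarrow>
     (\<exists>f. inj_on f {0..<fst H} \<and> f ` {0..<fst H} \<subseteq> {0..<N} \<and>
          (\<forall>i < fst H. \<forall>j < fst H. snd H i j \<longrightarrow> G (f i) (f j)))"

definition potentially_graphic :: "nat \<times> sgraph \<Rightarrow> nat list \<Rightarrow> bool" where
  "potentially_graphic H \<pi> \<longleftrightarrow>
     (\<exists>G. realizes G \<pi> \<and> contains_subgraph (length \<pi>) G H)"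

definition compl_seq :: "nat list \<Rightarrow> nat list" where
  "compl_seq \<pi> = map (\<lambda>d. length \<pi> - 1 - d) (rev \<pi>)"

definition complete_graph :: "nat \<Rightarrow> nat \<times> sgraph" where
  "complete_graph s = (s, \<lambda>i j. i < s \<and> j < s \<and> i \<noteq> j)"

definition star :: "nat \<Rightarrow> nat \<times> sgraph" where
  "star k = (k + 1, \<lambda>i j. i \<le> k \<and> j \<le> k \<and> i \<noteq> j \<and> (i = 0 \<or> j = 0))"

definition r_pot :: "nat \<times> sgraph \<Rightarrow> nat \<times> sgraph \<Rightarrow> nat" where
  "r_pot H1 H2 = (LEAST N. \<forall>\<pi>. length \<pi> = N \<and> sorted_wrt (\<ge>) \<pi> \<and> graphic \<pi> \<longrightarrow>
       potentially_graphic H1 \<pi> \<or> potentially_graphic H2 (compl_seq \<pi>))"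

end

(* A realization of the complementary sequence contains K_{1,t-1} iff some term d of an N-term
   sequence satisfies d <= N - t. So the upper bound amounts to: if N >= 2s and all terms are at
   least s - 1, then some realization contains K_s. As in the constructive proof of the Erdos-Gallai
   theorem by Tripathi, Venugopalan and West, start from the complete graph on the s vertices of
   largest prescribed degree and saturate the vertices in order of decreasing degree by switches
   that never delete a clique edge. If vertex r cannot be saturated, then either r is adjacent to
   the clique and the vertices up to r violate an Erdos-Gallai inequality, or r misses a clique
   vertex and the edges between the clique, the other vertices before r and those after r can be
   counted against N >= 2s. *)

theory Submission
  imports Defs
begin

section \<open>Degrees, edge counts and edge toggling\<close>

lemma is_graphD:
  assumes "is_graph N G"
  shows "G i j \<Longrightarrow> i < N" "G i j \<Longrightarrow> j < N" "\<not> G i i" "G i j \<Longrightarrow> G j i"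
  using assms unfolding is_graph_def by blast+

lemma degree_eq_card:
  assumes "is_graph N G"
  shows "degree N G i = card {j. G i j}"
  unfolding degree_def using is_graphD(2)[OF assms] by (metis (mono_tags, lifting))

lemma finite_neighbours:
  assumes "is_graph N G"
  shows "finite {j. G i j}"
  by (rule finite_subset[of _ "{..<N}"]) (use is_graphD(2)[OF assms] in auto)

lemma degree_eq_sum: "degree N G i = (\<Sum>j<N. of_bool (G i j))"
proof -
  have "(\<Sum>j<N. of_bool (G i j) :: nat) = card ({..<N} \<inter> {j. G i j})"
    by (simp add: of_bool_def sum.If_cases)
  also have "{..<N} \<inter> {j. G i j} = {j. j < N \<and> G i j}" by auto
  finally show ?thesis by (simp add: degree_def)
qed

text \<open>Handshake lemma, by growing the adjacency matrix: a new last row and column have equal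
  sums by symmetry, and the diagonal entry is 0.\<close>

lemma even_sum_degree:
  assumes "is_graph N G"
  shows "even (\<Sum>i<N. degree N G i)"
proof -
  have "even (\<Sum>i<n. \<Sum>j<n. of_bool (G i j) :: nat)" for n
  proof (induction n)
    case (Suc n)
    have "(\<Sum>i<n. of_bool (G i n) :: nat) = (\<Sum>i<n. of_bool (G n i))"
      by (intro sum.cong refl arg_cong[where f = of_bool]) (use is_graphD(4)[OF assms] in blast)
    then have "(\<Sum>i<Suc n. \<Sum>j<Suc n. of_bool (G i j) :: nat)
        = (\<Sum>i<n. \<Sum>j<n. of_bool (G i j)) + 2 * (\<Sum>i<n. of_bool (G n i))"
      using is_graphD(3)[OF assms] by (simp add: sum.distrib del: sum_of_bool_eq)
    then show ?case using Suc by (simp del: sum_of_bool_eq sum.lessThan_Suc)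
  qed simp
  then show ?thesis by (simp add: degree_eq_sum)
qed

text \<open>These are the two parts of an Erdos-Gallai bound: edges inside the first
  \<open>r + 1\<close> vertices, counted twice, and edges that come from later vertices.\<close>

lemma sum_degree_split:
  assumes "is_graph N G" "r < N"
  shows "(\<Sum>i\<le>r. degree N G i)
    = (\<Sum>i\<le>r. \<Sum>j\<le>r. of_bool (G i j)) + (\<Sum>k\<in>{r<..<N}. \<Sum>i\<le>r. of_bool (G k i))"
proof -
  have split: "{..<N} = {..r} \<union> {r<..<N}" using assms(2) by auto
  have "(\<Sum>i\<le>r. degree N G i)
      = (\<Sum>i\<le>r. (\<Sum>j\<le>r. of_bool (G i j)) + (\<Sum>k\<in>{r<..<N}. of_bool (G i k)))"
    unfolding degree_eq_sum split by (intro sum.cong refl sum.union_disjoint) auto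
  also have "\<dots> = (\<Sum>i\<le>r. \<Sum>j\<le>r. of_bool (G i j)) + (\<Sum>i\<le>r. \<Sum>k\<in>{r<..<N}. of_bool (G i k))"
    by (rule sum.distrib)
  also have "(\<Sum>i\<le>r. \<Sum>k\<in>{r<..<N}. of_bool (G i k) :: nat)
      = (\<Sum>k\<in>{r<..<N}. \<Sum>i\<le>r. of_bool (G i k))"
    by (rule sum.swap)
  also have "\<dots> = (\<Sum>k\<in>{r<..<N}. \<Sum>i\<le>r. of_bool (G k i))"
    by (intro sum.cong refl arg_cong[where f = of_bool]) (use is_graphD(4)[OF assms(1)] in blast)
  finally show ?thesis .
qed

text \<open>The exclusive or toggles one edge. Each switch below is a composite of toggles, so its
  effect on the degrees adds up by \<open>degree_flip\<close>.\<close>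

definition flip :: "nat \<Rightarrow> nat \<Rightarrow> sgraph \<Rightarrow> sgraph" where
  "flip x y G = (\<lambda>i j. G i j \<noteq> (i = x \<and> j = y \<or> i = y \<and> j = x))"

lemma is_graph_flip:
  assumes "is_graph N G" "x < N" "y < N" "x \<noteq> y"
  shows "is_graph N (flip x y G)"
  using assms unfolding is_graph_def flip_def by blast

lemma degree_flip:
  assumes "is_graph N G" "x < N" "y < N" "x \<noteq> y"
  shows "int (degree N (flip x y G) z)
    = int (degree N G z) + (if z = x \<or> z = y then if G x y then -1 else 1 else 0)"
proof -
  have *: "int (card {j. flip a b G a j}) = int (card {j. G a j}) + (if G a b then -1 else 1)"
    if "a \<noteq> b" for a b
  proof (cases "G a b")
    case True
    have "{j. flip a b G a j} = {j. G a j} - {b}"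
      using True that by (auto simp: flip_def)
    moreover have "card {j. G a j} > 0"
      using True finite_neighbours[OF assms(1)] by (auto simp: card_gt_0_iff)
    ultimately show ?thesis using True by (simp add: card_Diff_singleton)
  next
    case False
    have "{j. flip a b G a j} = insert b {j. G a j}"
      using False that by (auto simp: flip_def)
    then show ?thesis using False finite_neighbours[OF assms(1)] by simp
  qed
  have sym: "flip y x G = flip x y G" "G y x = G x y"
    using is_graphD(4)[OF assms(1)] by (auto simp: flip_def fun_eq_iff)
  have "{j. flip x y G z j} = {j. G z j}" if "z \<noteq> x" "z \<noteq> y"
    using that by (simp add: flip_def)
  then show ?thesis
    using *[of x y] *[of y x] assms(4) sym
    by (auto simp: degree_eq_card[OF is_graph_flip[OF assms]] degree_eq_card[OF assms(1)])
qed

section \<open>Partial realizations containing the clique, and switches that improve them\<close>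

locale clique_problem =
  fixes N s :: nat and d :: "nat \<Rightarrow> nat" and F :: sgraph
  assumes graph_F: "is_graph N F"
    and degree_F: "i < N \<Longrightarrow> degree N F i = d i"
    and antimono_d: "i \<le> j \<Longrightarrow> j < N \<Longrightarrow> d j \<le> d i"
    and min_d: "i < N \<Longrightarrow> s \<le> d i + 1"
    and size: "2 * s \<le> N"
begin

text \<open>Subrealizations containing the clique, exact below l, and edgeless from m on
  except for clique edges.\<close>

definition subreal :: "nat \<Rightarrow> nat \<Rightarrow> sgraph \<Rightarrow> bool" where
  "subreal l m H \<longleftrightarrow> is_graph N H \<and> (\<forall>i<s. \<forall>j<s. i \<noteq> j \<longrightarrow> H i j)
     \<and> (\<forall>i<N. degree N H i \<le> d i) \<and> (\<forall>i<l. degree N H i = d i)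
     \<and> (\<forall>i\<ge>m. \<forall>j\<ge>m. H i j \<longrightarrow> i < s \<and> j < s)"

end

text \<open>\<open>H\<close> has the greatest degree at \<open>r\<close> among its competitors, yet
  misses the target. A switch that would raise this degree without harm is therefore impossible,
  which gives the structural lemmas below.\<close>

locale stuck = clique_problem +
  fixes r :: nat and H :: sgraph
  assumes r_less: "r < N"
    and subreal_H: "subreal r (Suc r) H"
    and deficient_r: "degree N H r < d r"
    and maximal: "subreal r (Suc r) H' \<Longrightarrow> degree N H' r \<le> degree N H r"
begin

lemma graph_H: "is_graph N H"
  using subreal_H unfolding subreal_def by blast

lemmas H_less1 = is_graphD(1)[OF graph_H] and H_less2 = is_graphD(2)[OF graph_H]
  and H_irrefl [simp] = is_graphD(3)[OF graph_H] and H_sym = is_graphD(4)[OF graph_H]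

lemma H_comm: "H i j \<longleftrightarrow> H j i"
  using H_sym by blast

lemma clique_H: "i < s \<Longrightarrow> j < s \<Longrightarrow> i \<noteq> j \<Longrightarrow> H i j"
  using subreal_H unfolding subreal_def by blast

lemma degree_le: "i < N \<Longrightarrow> degree N H i \<le> d i"
  using subreal_H unfolding subreal_def by blast

lemma saturated: "i < r \<Longrightarrow> degree N H i = d i"
  using subreal_H unfolding subreal_def by blast

lemma no_edge_above:
  assumes "H i j" "r < i" "r < j"
  shows "i < s \<and> j < s"
proof -
  have "\<forall>i\<ge>Suc r. \<forall>j\<ge>Suc r. H i j \<longrightarrow> i < s \<and> j < s"
    using subreal_H unfolding subreal_def by (elim conjE)
  then show ?thesis using assms Suc_leI by blast
qed

text \<open>Conditions under which a switched graph still competes with \<open>H\<close>, phrased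
  relative to \<open>H\<close> so that they can be read off the toggled edges.\<close>

lemma no_improvement:
  assumes "is_graph N H'"
    and "\<And>i j. i < s \<Longrightarrow> j < s \<Longrightarrow> H i j \<Longrightarrow> H' i j"
    and "\<And>i. i < r \<Longrightarrow> degree N H' i = degree N H i"
    and "\<And>i. r < i \<Longrightarrow> i < N \<Longrightarrow> degree N H' i \<le> d i"
    and "\<And>i j. r < i \<Longrightarrow> r < j \<Longrightarrow> H' i j \<Longrightarrow> H i j"
    and "degree N H' r \<le> d r"
  shows "degree N H' r \<le> degree N H r"
proof (rule maximal)
  have "degree N H' i \<le> d i" if "i < N" for i
    using assms(3,4,6) that degree_le by (metis linorder_cases)
  moreover have "H' i j" if "i < s" "j < s" "i \<noteq> j" for i j
    using that by (intro assms(2) clique_H)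
  moreover have "degree N H' i = d i" if "i < r" for i
    using assms(3)[OF that] saturated[OF that] by simp
  moreover have "i < s \<and> j < s" if "Suc r \<le> i" "Suc r \<le> j" "H' i j" for i j
    using assms(5)[of i j] no_edge_above[of i j] that by (simp add: Suc_le_eq)
  ultimately show "subreal r (Suc r) H'"
    using assms(1) unfolding subreal_def by blast
qed

text \<open>Otherwise the edge between \<open>r\<close> and \<open>k\<close> could simply be
  added.\<close>

lemma deficient_adjacent:
  assumes "r < k" "k < N" "degree N H k < d k"
  shows "H r k"
proof (rule ccontr)
  assume n: "\<not> H r k"
  let ?H = "flip r k H"
  have deg: "int (degree N ?H z) = int (degree N H z) + (if z = r \<or> z = k then 1 else 0)" for z
    using n assms r_less by (subst degree_flip) (auto simp: graph_H)
  have "degree N ?H r \<le> degree N H r"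
  proof (rule no_improvement)
    show "is_graph N ?H" using assms r_less by (intro is_graph_flip graph_H) auto
    show "?H i j" if "H i j" for i j using that n H_sym by (auto simp: flip_def)
    show "degree N ?H i = degree N H i" if "i < r" for i using deg[of i] that assms by auto
    show "degree N ?H i \<le> d i" if "r < i" "i < N" for i
      using deg[of i] that assms degree_le[of i] by (auto split: if_splits)
    show "H i j" if "r < i" "r < j" "?H i j" for i j using that by (auto simp: flip_def)
    show "degree N ?H r \<le> d r" using deg[of r] deficient_r by auto
  qed
  then show False using deg[of r] by simp
qed

text \<open>If only one more edge is allowed at r, then by parity some later vertex is deficient too; it is
  adjacent to r, and removing that edge corrects the overshoot.\<close>

lemma no_double_improvement:
  assumes H': "is_graph N H'"
    and "\<And>i j. i < s \<Longrightarrow> j < s \<Longrightarrow> H i j \<Longrightarrow> H' i j"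
    and low: "\<And>i. i < r \<Longrightarrow> degree N H' i = degree N H i"
    and high: "\<And>i. r < i \<Longrightarrow> i < N \<Longrightarrow> degree N H' i \<le> degree N H i"
    and "\<And>i j. r < i \<Longrightarrow> r < j \<Longrightarrow> H' i j \<Longrightarrow> H i j"
    and adj: "\<And>k. H r k \<Longrightarrow> H' r k"
    and two: "degree N H' r = degree N H r + 2"
    and "s \<le> r"
  shows False
proof (cases "degree N H r + 2 \<le> d r")
  case True
  have "degree N H' r \<le> degree N H r"
    by (rule no_improvement[OF H' assms(2) low order_trans[OF high degree_le] assms(5)])
      (use two True in auto)
  then show False using two by simp
next
  case False
  then have dr: "d r = degree N H r + 1" using deficient_r by simp
  have "\<exists>k. r < k \<and> k < N \<and> degree N H k < d k"
  proof (rule ccontr)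
    assume "\<not> ?thesis"
    then have eq: "d i = degree N H i" if "i < N" "i \<noteq> r" for i
      using that saturated degree_le by (metis linorder_cases nat_less_le)
    have "(\<Sum>i<N. d i) = d r + (\<Sum>i\<in>{..<N} - {r}. d i)"
      using r_less by (subst sum.remove[of _ r]) auto
    also have "\<dots> = 1 + (degree N H r + (\<Sum>i\<in>{..<N} - {r}. degree N H i))"
      using eq dr by simp
    also have "\<dots> = 1 + (\<Sum>i<N. degree N H i)"
      using r_less by (subst sum.remove[of "{..<N}" r]) auto
    \<comment> \<open>All terms but that of \<open>r\<close> agree, so the prescribed sum exceeds an
      even one by 1; yet \<open>F\<close> shows that it is even.\<close>
    finally have "odd (\<Sum>i<N. d i)" using even_sum_degree[OF graph_H] by simp
    moreover have "(\<Sum>i<N. d i) = (\<Sum>i<N. degree N F i)" by (simp add: degree_F)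
    ultimately show False using even_sum_degree[OF graph_F] by simp
  qed
  then obtain k where k: "r < k" "k < N" "degree N H k < d k" by blast
  then have rk: "H' r k" using adj deficient_adjacent by blast
  let ?H = "flip r k H'"
  have deg: "int (degree N ?H z) = int (degree N H' z) + (if z = r \<or> z = k then -1 else 0)" for z
    using rk k r_less by (subst degree_flip) (auto simp: H')
  have "degree N ?H r \<le> degree N H r"
  proof (rule no_improvement)
    show "is_graph N ?H" using k r_less by (intro is_graph_flip H') auto
    show "?H i j" if "i < s" "j < s" "H i j" for i j
      using that assms(2)[OF that] \<open>s \<le> r\<close> by (auto simp: flip_def)
    show "degree N ?H i = degree N H i" if "i < r" for i using deg[of i] low[of i] that k by auto
    show "degree N ?H i \<le> d i" if "r < i" "i < N" for i
      using deg[of i] that high[of i] degree_le[of i] by (auto split: if_splits)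
    show "H i j" if "r < i" "r < j" "?H i j" for i j using that assms(5) by (auto simp: flip_def)
    show "degree N ?H r \<le> d r" using deg[of r] two dr by auto
  qed
  then show False using deg[of r] two by simp
qed

text \<open>As \<open>i\<close> is saturated and \<open>d\<close> is antimonotone, \<open>i\<close>
  has more neighbours than the deficient \<open>r\<close>. Later switches replace the edge
  \<open>i w\<close> by \<open>r w\<close>.\<close>

lemma private_neighbour:
  assumes "i < r"
  obtains w where "H i w" "\<not> H r w" "w \<noteq> r"
proof -
  have "degree N H r < degree N H i"
    using assms saturated antimono_d[of i r] r_less deficient_r by fastforce
  then have less: "card {j. H r j} < card {j. H i j}"
    by (simp add: degree_eq_card[OF graph_H])
  have fin: "finite {j. H x j}" for x by (rule finite_neighbours[OF graph_H])
  \<comment> \<open>A possible edge between \<open>i\<close> and \<open>r\<close> puts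
    \<open>r\<close> on one side and \<open>i\<close> on the other; discarding both keeps the
    comparison of sizes.\<close>
  have "\<not> {j. H i j} - {r} \<subseteq> {j. H r j} - {i}"
  proof
    assume sub: "{j. H i j} - {r} \<subseteq> {j. H r j} - {i}"
    show False
    proof (cases "H i r")
      case True
      then have "H r i" by (rule H_sym)
      with True sub less show False
        using card_mono[OF _ sub] fin card_gt_0_iff[of "{j. H r j}"]
        by (auto simp: card_Diff_singleton)
    next
      case False
      then have "{j. H i j} \<subseteq> {j. H r j}" using sub by blast
      then show False using less card_mono[OF fin, of "{j. H i j}" r] by simp
    qed
  qed
  then obtain w where "H i w" "w \<noteq> r" "\<not> (H r w \<and> w \<noteq> i)" by blast
  then have "\<not> H r w" by auto
  then show ?thesis using that \<open>H i w\<close> \<open>w \<noteq> r\<close> by blast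
qed

text \<open>Otherwise replace the edge \<open>x y\<close> by \<open>r x\<close> and
  \<open>r y\<close>: the degree of \<open>r\<close> grows by 2 and no other degree changes.\<close>

lemma nonneighbours_independent:
  assumes "H x y" "\<not> H r x" "\<not> H r y" "x \<noteq> r" "y \<noteq> r" "\<not> (x < s \<and> y < s)" "s \<le> r"
  shows False
proof -
  let ?H = "flip r y (flip r x (flip x y H))"
  have lt: "x < N" "y < N" using assms(1) H_less1 H_less2 by blast+
  have ne: "x \<noteq> y" using assms(1) by auto
  have deg: "int (degree N ?H z) = int (degree N H z) + (if z = r then 2 else 0)" for z
    using assms lt ne r_less H_comm
    by (simp add: degree_flip is_graph_flip graph_H) (auto simp: flip_def)
  show False
  proof (rule no_double_improvement)
    show "is_graph N ?H" using assms lt ne r_less by (intro is_graph_flip graph_H) auto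
    show "?H i j" if "i < s" "j < s" "H i j" for i j
      using that assms by (auto simp: flip_def)
    show "degree N ?H i = degree N H i" if "i < r" for i using deg[of i] that by auto
    show "degree N ?H i \<le> degree N H i" if "r < i" for i using deg[of i] that by auto
    show "H i j" if "r < i" "r < j" "?H i j" for i j
      using that assms H_sym by (auto simp: flip_def)
    show "?H r k" if "H r k" for k using that assms by (auto simp: flip_def)
    show "degree N ?H r = degree N H r + 2" using deg[of r] by simp
  qed (use assms in auto)
qed

text \<open>Otherwise replace \<open>x z\<close> by \<open>x r\<close>. Only \<open>z\<close> loses
  degree, which is harmless since \<open>z\<close> comes after \<open>r\<close>.\<close>

lemma nonneighbour_no_upper_edge:
  assumes "H x z" "\<not> H r x" "x \<noteq> r" "r < z" "\<not> (x < s \<and> z < s)"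
  shows False
proof -
  let ?H = "flip r x (flip x z H)"
  have lt: "x < N" "z < N" using assms(1) H_less1 H_less2 by blast+
  have ne: "x \<noteq> z" using assms(1) by auto
  have deg: "int (degree N ?H i)
      = int (degree N H i) + (if i = r then 1 else if i = z then -1 else 0)" for i
    using assms lt ne r_less H_comm
    by (simp add: degree_flip is_graph_flip graph_H) (auto simp: flip_def)
  have "degree N ?H r \<le> degree N H r"
  proof (rule no_improvement)
    show "is_graph N ?H" using assms lt ne r_less by (intro is_graph_flip graph_H) auto
    show "?H i j" if "i < s" "j < s" "H i j" for i j
      using that assms H_comm by (auto simp: flip_def)
    show "degree N ?H i = degree N H i" if "i < r" for i using deg[of i] that assms by auto
    show "degree N ?H i \<le> d i" if "r < i" "i < N" for i
      using deg[of i] that degree_le[of i] by (auto split: if_splits)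
    show "H i j" if "r < i" "r < j" "?H i j" for i j
      using that assms H_sym by (auto simp: flip_def)
    show "degree N ?H r \<le> d r" using deg[of r] deficient_r by auto
  qed
  then show False using deg[of r] by simp
qed

text \<open>Otherwise replace \<open>i w\<close> by \<open>r w\<close> and \<open>i k\<close>:
  \<open>i\<close> and \<open>w\<close> keep their degrees, while \<open>r\<close> and the deficient
  \<open>k\<close> gain 1.\<close>

lemma deficient_adjacent_below:
  assumes "i < r" "H i w" "\<not> H r w" "w \<noteq> r" "\<not> (i < s \<and> w < s)"
    and "r < k" "k < N" "degree N H k < d k"
  shows "H i k"
proof (rule ccontr)
  assume n: "\<not> H i k"
  let ?H = "flip i k (flip r w (flip i w H))"
  have lt: "i < N" "w < N" using assms(2) H_less1 H_less2 by blast+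
  have ne: "i \<noteq> w" "i \<noteq> r" "i \<noteq> k" "r \<noteq> k" "w \<noteq> k" using assms n by auto
  have deg: "int (degree N ?H z)
      = int (degree N H z) + (if z = r \<or> z = k then 1 else 0)" for z
    using assms lt ne r_less H_comm n
    by (simp add: degree_flip is_graph_flip graph_H) (auto simp: flip_def)
  have "degree N ?H r \<le> degree N H r"
  proof (rule no_improvement)
    show "is_graph N ?H" using assms lt ne r_less by (intro is_graph_flip graph_H) auto
    show "?H a b" if "a < s" "b < s" "H a b" for a b
      using that assms n H_comm by (auto simp: flip_def)
    show "degree N ?H a = degree N H a" if "a < r" for a using deg[of a] that assms by auto
    show "degree N ?H a \<le> d a" if "r < a" "a < N" for a
      using deg[of a] that degree_le[of a] assms by (auto split: if_splits)
    show "H a b" if "r < a" "r < b" "?H a b" for a b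
      using that assms by (auto simp: flip_def)
    show "degree N ?H r \<le> d r" using deg[of r] deficient_r by auto
  qed
  then show False using deg[of r] by simp
qed

text \<open>Otherwise replace \<open>i w\<close> and \<open>j z\<close> by \<open>r w\<close> and
  \<open>i j\<close>. Only \<open>r\<close> gains and only the later vertex \<open>z\<close> loses,
  even when \<open>w = z\<close>.\<close>

lemma adjacent_below_single:
  assumes "i < r" "j < r" "i \<noteq> j" "H i w" "\<not> H r w" "w \<noteq> r" "\<not> (i < s \<and> w < s)"
    and "H j z" "r < z" "\<not> (j < s \<and> z < s)"
  shows "H i j"
proof (rule ccontr)
  assume n: "\<not> H i j"
  let ?H = "flip i j (flip r w (flip j z (flip i w H)))"
  have lt: "i < N" "w < N" "j < N" "z < N" using assms(4,8)[THEN H_less1] assms(4,8)[THEN H_less2] by simp_all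
  have ne: "i \<noteq> w" "i \<noteq> r" "j \<noteq> r" "j \<noteq> z" "z \<noteq> r" "w \<noteq> j" "z \<noteq> i"
    using assms n H_comm by auto
  have e: "flip i w H j z" "\<not> flip j z (flip i w H) r w"
      "\<not> flip r w (flip j z (flip i w H)) i j"
    using assms ne n by (auto simp: flip_def)
  have deg: "int (degree N ?H x)
      = int (degree N H x) + (if x = r then 1 else if x = z then -1 else 0)" for x
    using assms(3,4,6) e lt ne r_less
    by (cases "w = z") (simp_all add: degree_flip is_graph_flip graph_H)
  have "degree N ?H r \<le> degree N H r"
  proof (rule no_improvement)
    show "is_graph N ?H" using assms(3,6) lt ne r_less by (simp add: is_graph_flip graph_H)
    show "?H a b" if "a < s" "b < s" "H a b" for a b
      using that assms n H_comm by (auto simp: flip_def)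
    show "degree N ?H a = degree N H a" if "a < r" for a using deg[of a] that assms(9) by simp
    show "degree N ?H a \<le> d a" if "r < a" "a < N" for a
      using deg[of a] that degree_le[of a] by (simp split: if_splits)
    show "H a b" if "r < a" "r < b" "?H a b" for a b
      using that assms by (auto simp: flip_def)
    show "degree N ?H r \<le> d r" using deg[of r] deficient_r by simp
  qed
  then show False using deg[of r] by simp
qed

text \<open>Otherwise replace \<open>i w\<close> and \<open>j z\<close> by \<open>r w\<close>,
  \<open>r z\<close> and \<open>i j\<close>, which raises \<open>r\<close> by 2. Here
  \<open>w \<noteq> z\<close> makes the new edges at \<open>r\<close> distinct, and
  \<open>s \<le> i\<close>, \<open>s \<le> j\<close> protect the clique.\<close>

lemma adjacent_below_double:
  assumes "i < r" "j < r" "i \<noteq> j" "s \<le> i" "s \<le> j" "w \<noteq> z"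
    and "H i w" "\<not> H r w" "w \<noteq> r" "H j z" "\<not> H r z" "z \<noteq> r"
  shows "H i j"
proof (rule ccontr)
  assume n: "\<not> H i j"
  let ?H = "flip i j (flip r z (flip r w (flip j z (flip i w H))))"
  have lt: "i < N" "w < N" "j < N" "z < N" using assms(7,10)[THEN H_less1] assms(7,10)[THEN H_less2] by simp_all
  have ne: "i \<noteq> w" "i \<noteq> r" "j \<noteq> r" "j \<noteq> z" "w \<noteq> j" "z \<noteq> i"
    using assms n H_comm by auto
  have e: "flip i w H j z" "\<not> flip j z (flip i w H) r w"
      "\<not> flip r w (flip j z (flip i w H)) r z"
      "\<not> flip r z (flip r w (flip j z (flip i w H))) i j"
    using assms ne n by (auto simp: flip_def)
  have deg: "int (degree N ?H x) = int (degree N H x) + (if x = r then 2 else 0)" for x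
    using assms(3,6,7,9,12) e lt ne r_less
    by (simp add: degree_flip is_graph_flip graph_H)
  show False
  proof (rule no_double_improvement)
    show "is_graph N ?H" using assms(3,9,12) lt ne r_less by (simp add: is_graph_flip graph_H)
    show "?H a b" if "a < s" "b < s" "H a b" for a b
      using that assms n H_comm by (auto simp: flip_def)
    show "degree N ?H a = degree N H a" if "a < r" for a using deg[of a] that by auto
    show "degree N ?H a \<le> degree N H a" if "r < a" for a using deg[of a] that by auto
    show "H a b" if "r < a" "r < b" "?H a b" for a b
      using that assms by (auto simp: flip_def)
    show "?H r k" if "H r k" for k using that assms ne by (auto simp: flip_def)
    show "degree N ?H r = degree N H r + 2" using deg[of r] by simp
  qed (use assms in auto)
qed

section \<open>Refuting a stuck configuration\<close>

lemma low_neighbour: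
  assumes "i < r" "s \<le> i"
  shows "H r i"
proof (rule ccontr)
  assume n: "\<not> H r i"
  obtain w where "H i w" "\<not> H r w" "w \<noteq> r" using private_neighbour[OF assms(1)] by blast
  \<comment> \<open>\<open>i\<close> and its private neighbour would be adjacent nonneighbours of
    \<open>r\<close>, joined by an edge outside the clique.\<close>
  then show False using nonneighbours_independent[of i w] n assms by simp
qed

text \<open>If r is adjacent to the whole prescribed clique, the set of vertices up to r violates
  the necessary Erdos-Gallai inequality, which the given realization F satisfies.\<close>

lemma contradiction_if_adjacent_to_clique:
  assumes all: "\<And>a. a < s \<Longrightarrow> a \<noteq> r \<Longrightarrow> H r a"
  shows False
proof -
  \<comment> \<open>Hence every private neighbour lies after \<open>r\<close> and outside the
    clique, so the single switch applies to any two vertices before \<open>r\<close>.\<close>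
  have nonneighbour: "s \<le> w \<and> r < w" if "w \<noteq> r" "\<not> H r w" for w
    using all low_neighbour that by (meson linorder_neqE_nat not_less)
  have adj_r: "H r i" if "i < r" for i
    using all[of i] low_neighbour[of i] that by fastforce
  have below: "H i j" if ij: "i < r" "j < r" "i \<noteq> j" for i j
  proof -
    obtain w where w: "H i w" "\<not> H r w" "w \<noteq> r" using private_neighbour[OF ij(1)] by blast
    obtain z where z: "H j z" "\<not> H r z" "z \<noteq> r" using private_neighbour[OF ij(2)] by blast
    show ?thesis
      by (rule adjacent_below_single[of i j w z])
        (use ij w z nonneighbour[of w] nonneighbour[of z] in auto)
  qed
  have complete: "H i j" if "i \<le> r" "j \<le> r" "i \<noteq> j" for i j
    using that below[of i j] adj_r H_sym by (metis le_neq_implies_less)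
  have deficient: "H k i" if k: "r < k" "k < N" "degree N H k < d k" and i: "i \<le> r" for k i
  proof (cases "i = r")
    case True
    then show ?thesis using deficient_adjacent[OF k] H_sym by blast
  next
    case False
    then have "i < r" using i by simp
    then obtain w where w: "H i w" "\<not> H r w" "w \<noteq> r" using private_neighbour by blast
    then have "\<not> (i < s \<and> w < s)" using nonneighbour[of w] by auto
    then show ?thesis using deficient_adjacent_below[OF \<open>i < r\<close> w _ k] H_sym by blast
  qed
  \<comment> \<open>A later vertex that is in the clique or deficient is joined to everything up to
    \<open>r\<close>; any other has its full prescribed degree and all its
    \<open>H\<close>-neighbours there.\<close>
  have upper: "(\<Sum>i\<le>r. of_bool (F k i) :: nat) \<le> (\<Sum>i\<le>r. of_bool (H k i))"
    if k: "k \<in> {r<..<N}" for k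
  proof (cases "k < s \<or> degree N H k < d k")
    case True
    then have "H k i" if "i \<le> r" for i
      using that k clique_H[of k i] deficient[of k i] by auto
    then show ?thesis by (intro sum_mono) simp
  next
    case False
    have "(\<Sum>i\<le>r. of_bool (F k i) :: nat) \<le> (\<Sum>i<N. of_bool (F k i))"
      using r_less by (intro sum_mono2) auto
    also have "\<dots> = degree N H k"
      using k False degree_F[of k] degree_le[of k] by (simp only: degree_eq_sum[symmetric]) simp
    also have "\<dots> = (\<Sum>i\<le>r. of_bool (H k i))"
      unfolding degree_eq_sum
      by (rule sum.mono_neutral_right) (use r_less k False no_edge_above[of k] in \<open>auto simp: not_le\<close>)
    finally show ?thesis .
  qed
  have "(\<Sum>i\<le>r. d i) = (\<Sum>i\<le>r. degree N F i)"
    using r_less by (intro sum.cong) (auto simp: degree_F)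
  also have "\<dots> = (\<Sum>i\<le>r. \<Sum>j\<le>r. of_bool (F i j)) + (\<Sum>k\<in>{r<..<N}. \<Sum>i\<le>r. of_bool (F k i))"
    by (rule sum_degree_split[OF graph_F r_less])
  also have "\<dots> \<le> (\<Sum>i\<le>r. \<Sum>j\<le>r. of_bool (H i j)) + (\<Sum>k\<in>{r<..<N}. \<Sum>i\<le>r. of_bool (H k i))"
  proof (rule add_mono)
    have "of_bool (F i j) \<le> (of_bool (H i j) :: nat)" if "i \<le> r" "j \<le> r" for i j
      using complete[OF that] is_graphD(3)[OF graph_F] by (cases "i = j") auto
    then show "(\<Sum>i\<le>r. \<Sum>j\<le>r. of_bool (F i j) :: nat) \<le> (\<Sum>i\<le>r. \<Sum>j\<le>r. of_bool (H i j))"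
      by (intro sum_mono) auto
  qed (intro sum_mono upper)
  also have "\<dots> = (\<Sum>i\<le>r. degree N H i)"
    by (rule sum_degree_split[OF graph_H r_less, symmetric])
  also have "\<dots> < (\<Sum>i\<le>r. d i)"
    by (rule sum_strict_mono_ex1) (use r_less degree_le deficient_r in auto)
  finally show False by simp
qed

text \<open>Here A is the clique, B the saturated vertices between A and r, and T the vertices after r. The
  stuck configuration forces B to be complete and joined to r and to P, the clique vertices with
  neighbours in T. The degrees in B are at most that of its first vertex, and summing them
  contradicts the number of edges that A and T must send to B.\<close>

lemma contradiction_if_clique_nonneighbour:
  assumes u: "u < s" "u \<noteq> r" "\<not> H r u"
  shows False
proof -
  define A B T where "A = {..<s}" and "B = {s..<r}" and "T = {r<..<N}"
  define e :: "nat \<Rightarrow> nat set \<Rightarrow> int" where "e x S = (\<Sum>j\<in>S. of_bool (H x j))" for x S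
  have s_le_r: "s \<le> r" using u clique_H[of r u] by force
  have fin [simp]: "finite A" "finite B" "finite T" by (simp_all add: A_def B_def T_def)
  have degree_split: "int (degree N H x) = e x A + e x B + of_bool (H x r) + e x T" for x
  proof -
    have "{..<N} = A \<union> B \<union> {r} \<union> T"
      using s_le_r r_less by (auto simp: A_def B_def T_def)
    moreover have "A \<inter> B = {}" "(A \<union> B) \<inter> {r} = {}" "(A \<union> B \<union> {r}) \<inter> T = {}"
      using s_le_r by (auto simp: A_def B_def T_def)
    ultimately show ?thesis
      by (simp add: degree_eq_sum e_def sum.union_disjoint del: sum_of_bool_eq)
  qed
  have e_swap: "(\<Sum>x\<in>S. e x S') = (\<Sum>x\<in>S'. e x S)" for S S'
    unfolding e_def by (subst sum.swap) (simp add: H_comm)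
  have e_nonneg: "e x S \<ge> 0" for x S by (simp add: e_def sum_nonneg del: sum_of_bool_eq)
  have e_le: "e x S \<le> int (card S')" if "\<And>j. j \<in> S \<Longrightarrow> H x j \<Longrightarrow> j \<in> S'" "finite S" "finite S'" for x S S'
    using that unfolding e_def by (auto simp: Int_def intro!: card_mono)
  have e_full: "e x S = int (card S)" if "\<And>j. j \<in> S \<Longrightarrow> H x j" for x S
    using that unfolding e_def by (simp del: sum_of_bool_eq)
  have e_zero: "e x S = 0" if "\<And>j. j \<in> S \<Longrightarrow> \<not> H x j" for x S
    using that unfolding e_def by (simp del: sum_of_bool_eq)
  have e_clique: "e x S = int (card S) - 1" if "\<And>j. j \<in> S \<Longrightarrow> j \<noteq> x \<Longrightarrow> H x j" "finite S" "x \<in> S" for x S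
  proof -
    have "e x S = int (card (S - {x}))"
      using that unfolding e_def by (subst sum.remove[of _ x]) (auto simp del: sum_of_bool_eq card_Diff_singleton)
    then show ?thesis using card.remove[OF that(2,3)] by simp
  qed

  have B_complete: "H b b'" if b: "b \<in> B" "b' \<in> B" "b \<noteq> b'" for b b'
  proof (rule ccontr)
    assume n: "\<not> H b b'"
    have lt: "b < r" "b' < r" "s \<le> b" "s \<le> b'" using b by (auto simp: B_def)
    obtain w where w: "H b w" "\<not> H r w" "w \<noteq> r" using private_neighbour[OF lt(1)] by blast
    \<comment> \<open>By the double switch, a neighbour of \<open>b'\<close> is \<open>r\<close>,
      \<open>w\<close> or a neighbour of \<open>r\<close>. The extra \<open>r\<close> and
      \<open>w\<close> are offset by \<open>b\<close> and \<open>b'\<close>, neighbours of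
      \<open>r\<close> but not of \<open>b'\<close>. So \<open>b'\<close> would have at most the
      degree of \<open>r\<close>.\<close>
    have "{z. H b' z} \<subseteq> insert r (insert w {z. H r z}) - {b, b'}"
      using adjacent_below_double[of b b' w] lt b(3) w n H_comm by fastforce
    moreover have "b \<in> {z. H r z}" "b' \<in> {z. H r z}" using low_neighbour lt by auto
    moreover have "card (insert r (insert w {z. H r z}) - {b, b'}) = card (insert r (insert w {z. H r z})) - 2"
      using calculation(2,3) b(3) by (subst card_Diff_subset) auto
    moreover have "card (insert r (insert w {z. H r z})) \<le> card {z. H r z} + 2"
      using card_insert_le_m1 finite_neighbours[OF graph_H] by (simp add: card_insert_if)
    ultimately have "degree N H b' \<le> degree N H r"
      using card_mono[of "insert r (insert w {z. H r z}) - {b, b'}" "{z. H b' z}"]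
        finite_neighbours[OF graph_H] by (auto simp: degree_eq_card[OF graph_H])
    then show False
      using saturated[OF lt(2)] deficient_r antimono_d[of b' r] lt r_less by simp
  qed
  define P where "P = {a \<in> A. \<exists>z\<in>T. H a z}"
  define A' where "A' = {a \<in> A. H r a}"
  have P_sub: "P \<subseteq> A'"
    using nonneighbour_no_upper_edge s_le_r by (fastforce simp: P_def A'_def A_def T_def)
  have [simp]: "finite P" "finite A'" by (simp_all add: P_def A'_def)
  have P_complete: "H a b" if ab: "a \<in> P" "b \<in> B" for a b
  proof -
    have b: "b < r" "s \<le> b" using ab by (auto simp: B_def)
    obtain w where w: "H b w" "\<not> H r w" "w \<noteq> r" using private_neighbour[OF b(1)] by blast
    obtain z where "a < s" "r < z" "H a z" using ab by (auto simp: P_def A_def T_def)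
    then have "H b a"
      by (intro adjacent_below_single[of b a w z]) (use w b s_le_r in auto)
    then show ?thesis by (rule H_sym)
  qed
  have r_B: "H r b" if "b \<in> B" for b using low_neighbour that by (simp add: B_def)
  have T_indep: "\<not> H x y" if "x \<in> T" "y \<in> T" for x y
    using no_edge_above[of x y] that s_le_r by (auto simp: T_def)

  \<comment> \<open>\<open>g0\<close> is the excess of \<open>d s\<close> over \<open>s - 1\<close>,
    hence a lower bound for the neighbours that each clique vertex needs outside the clique.\<close>
  define Q p \<alpha> t1 g0 E where "Q = int (card B)" and "p = int (card P)" and "\<alpha> = int (card A')"
    and "t1 = e r T" and "g0 = int (d s) - int s + 1" and "E = (\<Sum>z\<in>T. e z B)"
  have Q_eq: "Q = int r - int s" using s_le_r by (simp add: Q_def B_def)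
  have g0_nonneg: "g0 \<ge> 0" using min_d[of s] s_le_r r_less by (simp add: g0_def)
  have d_A: "int (d a) - int s + 1 \<ge> g0" if "a \<in> A" for a
    using antimono_d[of a s] that s_le_r r_less by (simp add: g0_def A_def)
  have e_A: "e a A = int s - 1" if "a \<in> A" for a
    using e_clique[of A a] clique_H that by (force simp: A_def)
  have degree_A: "int (degree N H a) = int (d a)" if "a \<in> A" for a
    using saturated[of a] that s_le_r by (simp add: A_def)
  have e_T: "e a T = 0" if "a \<in> A" "a \<notin> P" for a
    using that by (intro e_zero) (auto simp: P_def)
  \<comment> \<open>A vertex of \<open>P\<close> sees all of \<open>B\<close>. Any other clique
    vertex sees nothing in \<open>T\<close>, so its outside neighbours lie in \<open>B\<close>,
    except possibly \<open>r\<close>. The \<open>+ 1\<close> for \<open>P\<close> cancels the term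
    for \<open>A'\<close>, as \<open>P \<subseteq> A'\<close>.\<close>
  have e_B: "e a B \<ge> g0 + of_bool (a \<in> P) * (Q - g0 + 1) - of_bool (a \<in> A')" if a: "a \<in> A" for a
  proof (cases "a \<in> P")
    case True
    then have "e a B = Q" unfolding Q_def by (intro e_full P_complete)
    then show ?thesis using True P_sub by auto
  next
    case False
    then show ?thesis
      using degree_split[of a] degree_A[OF a] e_A[OF a] e_T[OF a] d_A[OF a] a
      by (simp add: A'_def H_comm[of a r])
  qed
  \<comment> \<open>The previous bound is evaluated at \<open>u\<close>, which lies in neither
    \<open>A'\<close> nor \<open>P\<close>.\<close>
  have g0_le: "g0 \<le> Q"
  proof -
    have a: "u \<in> A" "u \<notin> A'" using u by (auto simp: A_def A'_def)
    then have "u \<notin> P" using P_sub by blast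
    then have "g0 \<le> e u B" using e_B[of u] a by simp
    also have "\<dots> \<le> Q" unfolding Q_def by (rule e_le) auto
    finally show ?thesis .
  qed
  have degree_r: "\<alpha> + Q + t1 \<le> int s + g0 - 2"
  proof -
    have "e r A = \<alpha>" unfolding \<alpha>_def e_def A'_def by (simp add: Int_def)
    moreover have "e r B = Q" unfolding Q_def by (intro e_full r_B)
    moreover have "int (degree N H r) < int (d s)"
      using deficient_r antimono_d[of s r] s_le_r r_less by simp
    ultimately show ?thesis using degree_split[of r] by (simp add: t1_def g0_def)
  qed
  have e_P: "e z A \<le> p" if "z \<in> T" for z
    unfolding p_def using that H_comm by (intro e_le) (auto simp: P_def)
  \<comment> \<open>\<open>z\<close> needs degree at least \<open>s - 1\<close> and can meet only
    \<open>P\<close>, \<open>B\<close> and \<open>r\<close>.\<close>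
  have upper_saturated: "e z B \<ge> int s - 1 - p - of_bool (H r z)"
    if z: "z \<in> T" "degree N H z = d z" for z
    using degree_split[of z] e_P[OF z(1)] e_zero[of T z] T_indep[OF z(1)] min_d[of z] z
    by (auto simp: T_def H_comm[of z r])
  have upper_deficient: "e z B = Q" if z: "z \<in> T" "degree N H z \<noteq> d z" for z
    unfolding Q_def
  proof (rule e_full)
    fix b assume "b \<in> B"
    then have b: "b < r" "s \<le> b" by (auto simp: B_def)
    obtain w where w: "H b w" "\<not> H r w" "w \<noteq> r" using private_neighbour[OF b(1)] by blast
    have "degree N H z < d z" using degree_le[of z] z by (simp add: T_def)
    then have "H b z"
      by (intro deficient_adjacent_below[of b w z]) (use b w z in \<open>auto simp: T_def\<close>)
    then show "H z b" by (rule H_sym)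
  qed
  \<comment> \<open>Sum the degrees over \<open>B\<close>: each is at most \<open>d s\<close> and
    consists of the edges to the clique, \<open>Q - 1\<close> within \<open>B\<close>, one to
    \<open>r\<close>, and those to \<open>T\<close>.\<close>
  have main: "Q * Q + int s * g0 + p * (Q - g0 + 1) - \<alpha> + E \<le> Q * (int s - 1 + g0)"
  proof -
    have "int s * g0 + p * (Q - g0 + 1) - \<alpha>
        = (\<Sum>a\<in>A. g0 + of_bool (a \<in> P) * (Q - g0 + 1) - of_bool (a \<in> A'))"
    proof -
      have "A \<inter> {x. x \<in> P} = P" "A \<inter> {x. x \<in> A'} = A'" by (auto simp: P_def A'_def)
      then show ?thesis
        by (simp add: sum.distrib sum_subtractf sum_distrib_right[symmetric] p_def \<alpha>_def)
          (simp add: A_def)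
    qed
    also have "\<dots> \<le> (\<Sum>a\<in>A. e a B)" by (intro sum_mono e_B)
    finally have 1: "int s * g0 + p * (Q - g0 + 1) - \<alpha> \<le> (\<Sum>b\<in>B. e b A)"
      by (simp add: e_swap)
    have "(\<Sum>b\<in>B. e b A) + Q * Q + E = (\<Sum>b\<in>B. e b A + Q + e b T)"
      by (simp add: sum.distrib E_def e_swap[of T B] Q_def)
    also have "\<dots> = (\<Sum>b\<in>B. int (degree N H b))"
    proof (rule sum.cong)
      fix b assume b: "b \<in> B"
      have "e b B = Q - 1" unfolding Q_def using B_complete b by (intro e_clique) auto
      then show "e b A + Q + e b T = int (degree N H b)"
        using degree_split[of b] r_B[OF b] H_sym by auto
    qed simp
    also have "\<dots> \<le> (\<Sum>b\<in>B. int (d s))"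
    proof (rule sum_mono)
      fix b assume "b \<in> B"
      then have "degree N H b = d b" "d b \<le> d s"
        using saturated[of b] antimono_d[of s b] r_less by (auto simp: B_def)
      then show "int (degree N H b) \<le> int (d s)" by simp
    qed
    finally show ?thesis using 1 by (simp add: Q_def g0_def)
  qed
  have E_nonneg: "E \<ge> 0" unfolding E_def by (intro sum_nonneg e_nonneg)
  have t1_nonneg: "t1 \<ge> 0" unfolding t1_def by (rule e_nonneg)
  define y where "y = int s - 1 - p"
  have main': "(Q - y) * (Q - g0) + g0 + p - \<alpha> + E \<le> 0"
    using main unfolding y_def by (simp add: algebra_simps)
  show False
  proof (cases "\<exists>z\<in>T. \<not> H r z")
    case True
    \<comment> \<open>Such a \<open>z\<close> is saturated and sends at least \<open>y\<close> edges
      to \<open>B\<close>. So \<open>E\<close> and \<open>Q\<close> are at least \<open>y\<close>,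
      and the bound on the degree of \<open>r\<close> is contradicted.\<close>
    then obtain z where z: "z \<in> T" "\<not> H r z" by blast
    then have "degree N H z = d z"
      using deficient_adjacent[of z] degree_le[of z] by (auto simp: T_def le_less)
    then have 1: "y \<le> e z B" using upper_saturated[OF z(1)] z(2) by (simp add: y_def)
    also have "e z B \<le> E" unfolding E_def using z(1) e_nonneg by (intro member_le_sum) auto
    finally have "y \<le> E" .
    moreover have "e z B \<le> Q" unfolding Q_def by (rule e_le) auto
    then have "(Q - y) * (Q - g0) \<ge> 0" using 1 g0_le by simp
    ultimately show False
      using main' g0_nonneg degree_r g0_le t1_nonneg by (simp add: y_def)
  next
    case False
    then have "t1 = int (card T)" unfolding t1_def by (intro e_full) blast
    \<comment> \<open>Here \<open>2 * s \<le> N\<close> enters: \<open>T\<close> has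
      \<open>N - 1 - r\<close> vertices, all adjacent to \<open>r\<close>.\<close>
    then have t1: "t1 \<ge> y + p - Q"
      using size r_less by (simp add: T_def Q_eq y_def)
    then have pos: "g0 + p - \<alpha> > 0"
      using degree_r unfolding y_def p_def by linarith
    show False
    proof (cases "y \<le> Q")
      case True
      then have "(Q - y) * (Q - g0) \<ge> 0" using g0_le by simp
      then show False using main' pos E_nonneg by linarith
    next
      case False
      \<comment> \<open>Now \<open>Q \<le> y - 1\<close>, which a saturated vertex of
        \<open>T\<close> sends to \<open>B\<close> at least; a deficient one is joined to all of
        \<open>B\<close>. The resulting \<open>E \<ge> t1 * Q\<close> outweighs the possibly
        negative product in \<open>main'\<close>.\<close>
      have "e z B \<ge> Q" if "z \<in> T" for z
      proof (cases "degree N H z = d z")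
        case True
        have "of_bool (H r z) \<le> (1::int)" by simp
        then show ?thesis using upper_saturated[OF that True] False unfolding y_def by linarith
      next
        case False
        then show ?thesis using upper_deficient[OF that] by simp
      qed
      then have "E \<ge> (\<Sum>z\<in>T. Q)" unfolding E_def by (intro sum_mono)
      then have "E \<ge> t1 * Q" using \<open>t1 = int (card T)\<close> by simp
      moreover have "t1 * Q \<ge> (y + p - Q) * Q"
        using t1 by (intro mult_right_mono) (simp_all add: Q_def)
      moreover have "(Q - y) * (Q - g0) + (y + p - Q) * Q = (y - Q) * g0 + p * Q"
        by (simp add: algebra_simps)
      moreover have "(y - Q) * g0 \<ge> 0" using False g0_nonneg by simp
      moreover have "p * Q \<ge> 0" by (simp add: p_def Q_def)
      ultimately show False using main' pos by linarith
    qed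
  qed
qed

end

section \<open>Saturating the vertices one by one\<close>

context clique_problem
begin

lemma subreal_step:
  assumes "subreal l l H" "l < N"
  shows "\<exists>H'. subreal (Suc l) (Suc l) H'"
proof -
  have start: "subreal l (Suc l) H" using assms(1) unfolding subreal_def by (meson Suc_leD)
  have bound: "\<forall>G. subreal l (Suc l) G \<longrightarrow> degree N G l < Suc (d l)"
    using assms(2) unfolding subreal_def less_Suc_eq_le by blast
  obtain H' where H': "subreal l (Suc l) H'"
    and max: "\<And>G. subreal l (Suc l) G \<Longrightarrow> degree N G l \<le> degree N H' l"
    using ex_has_greatest_nat[OF start bound] by (elim exE conjE) simp
  have "degree N H' l = d l"
  proof (rule ccontr)
    assume "degree N H' l \<noteq> d l"
    moreover have "degree N H' l \<le> d l" using H' assms(2) unfolding subreal_def by blast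
    ultimately have less: "degree N H' l < d l" by simp
    interpret stuck N s d F l H'
      by unfold_locales (fact assms(2) H' less | erule max)+
    show False
      by (rule contradiction_if_adjacent_to_clique)
        (use contradiction_if_clique_nonneighbour in blast)
  qed
  then have "subreal (Suc l) (Suc l) H'" using H' unfolding subreal_def All_less_Suc by blast
  then show ?thesis by (rule exI[where x = H'])
qed

text \<open>Start from the bare clique, which respects the targets by \<open>min_d\<close>, and
  saturate vertex after vertex up to \<open>N\<close>.\<close>

lemma ex_realization_with_clique:
  obtains H where "is_graph N H" "\<And>i. i < N \<Longrightarrow> degree N H i = d i"
    "\<And>i j. i < s \<Longrightarrow> j < s \<Longrightarrow> i \<noteq> j \<Longrightarrow> H i j"
proof -
  have "\<exists>H. subreal l l H" if "l \<le> N" for l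
    using that
  proof (induction l)
    case 0
    let ?H = "\<lambda>i j. i < s \<and> j < s \<and> i \<noteq> j"
    have graph: "is_graph N ?H" using size by (auto simp: is_graph_def)
    have "degree N ?H i \<le> d i" if "i < N" for i
    proof (cases "i < s")
      case True
      then have "{j. ?H i j} = {..<s} - {i}" by auto
      then show ?thesis using True min_d[OF that] by (simp add: degree_eq_card[OF graph])
    qed (simp add: degree_def)
    then have "subreal 0 0 ?H" using graph by (auto simp: subreal_def)
    then show ?case by blast
  next
    case (Suc l)
    then show ?case using subreal_step by (meson Suc_le_eq less_imp_le_nat)
  qed
  then obtain H where "subreal N N H" by blast
  then show ?thesis using that by (auto simp: subreal_def)
qed

end

section \<open>Cliques, stars and complementary sequences\<close>

lemma contains_complete_graphD:
  assumes "contains_subgraph N G (complete_graph s)"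
  obtains X where "X \<subseteq> {..<N}" "card X = s" "\<And>x y. x \<in> X \<Longrightarrow> y \<in> X \<Longrightarrow> x \<noteq> y \<Longrightarrow> G x y"
proof -
  obtain f where f: "inj_on f {0..<s}" "f ` {0..<s} \<subseteq> {0..<N}"
    "\<And>i j. i < s \<Longrightarrow> j < s \<Longrightarrow> i \<noteq> j \<Longrightarrow> G (f i) (f j)"
    using assms unfolding contains_subgraph_def complete_graph_def by auto
  show ?thesis
  proof (rule that[of "f ` {0..<s}"])
    show "card (f ` {0..<s}) = s" using f(1) by (simp add: card_image)
    show "G x y" if "x \<in> f ` {0..<s}" "y \<in> f ` {0..<s}" "x \<noteq> y" for x y
      using that f(3) by fastforce
  qed (use f(2) in auto)
qed

lemma contains_star_iff:
  assumes G: "is_graph N G" and "N > 0"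
  shows "contains_subgraph N G (star k) \<longleftrightarrow> (\<exists>i<N. k \<le> degree N G i)"
proof
  assume "contains_subgraph N G (star k)"
  then obtain f where f: "inj_on f {0..<k + 1}" "f ` {0..<k + 1} \<subseteq> {0..<N}"
    "\<And>j. j \<le> k \<Longrightarrow> j \<noteq> 0 \<Longrightarrow> G (f 0) (f j)"
    unfolding contains_subgraph_def star_def by auto
  have "inj_on f {1..k}" by (rule inj_on_subset[OF f(1)]) auto
  then have "k = card (f ` {1..k})" by (simp add: card_image)
  also have "\<dots> \<le> card {j. G (f 0) j}"
    using f(3) by (intro card_mono finite_neighbours[OF G]) auto
  finally show "\<exists>i<N. k \<le> degree N G i"
    using f(2) by (intro exI[of _ "f 0"]) (simp add: degree_eq_card[OF G] image_subset_iff)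
next
  assume "\<exists>i<N. k \<le> degree N G i"
  then obtain i where i: "i < N" "k \<le> card {j. G i j}" by (auto simp: degree_eq_card[OF G])
  then obtain S where S: "S \<subseteq> {j. G i j}" "card S = k" "finite S"
    using obtain_subset_with_card_n by blast
  then obtain g where g: "bij_betw g {0..<k} S" using ex_bij_betw_nat_finite by blast
  \<comment> \<open>0 is the centre of the star, so the leaves 1 to \<open>k\<close> are shifted
    down into the domain of \<open>g\<close>.\<close>
  define f where "f j = (if j = 0 then i else g (j - 1))" for j
  have g_in: "G i (g j)" if "j < k" for j
    using that g S(1) unfolding bij_betw_def by fastforce
  have f_in: "G i (f j)" if "0 < j" "j \<le> k" for j using that g_in by (simp add: f_def)
  have "inj_on f {0..<k + 1}"
  proof (rule inj_onI)
    fix a b assume ab: "a \<in> {0..<k + 1}" "b \<in> {0..<k + 1}" "f a = f b"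
    show "a = b"
    proof (cases "a = 0 \<or> b = 0")
      case True
      then show ?thesis
        using ab f_in[of a] f_in[of b] is_graphD(3)[OF G, of i] by (auto simp: f_def split: if_splits)
    next
      case False
      then have "g (a - 1) = g (b - 1)" using ab by (simp add: f_def)
      then have "a - 1 = b - 1"
        using False ab g inj_onD[of g "{0..<k}" "a - 1" "b - 1"] by (auto simp: bij_betw_def)
      then show ?thesis using False by (simp add: Suc_pred' eq_diff_iff)
    qed
  qed
  moreover have "f j < N" if "j \<le> k" for j
    using i(1) f_in[of j] that is_graphD(2)[OF G] by (cases "j = 0") (auto simp: f_def)
  moreover have "G (f a) (f b)" if "a \<le> k" "b \<le> k" "a \<noteq> b" "a = 0 \<or> b = 0" for a b
    using that f_in[of a] f_in[of b] is_graphD(4)[OF G] by (auto simp: f_def)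
  ultimately show "contains_subgraph N G (star k)"
    unfolding contains_subgraph_def star_def by (intro exI[of _ f]) (auto simp: less_Suc_eq_le)
qed

lemma length_compl_seq [simp]: "length (compl_seq \<pi>) = length \<pi>"
  by (simp add: compl_seq_def)

lemma set_compl_seq: "set (compl_seq \<pi>) = (\<lambda>d. length \<pi> - 1 - d) ` set \<pi>"
  by (simp add: compl_seq_def)

lemma graphic_compl_seq:
  assumes "graphic \<pi>"
  shows "graphic (compl_seq \<pi>)"
proof -
  obtain G where "realizes G \<pi>" using assms by (auto simp: graphic_def)
  then have G: "is_graph (length \<pi>) G" and deg: "\<And>i. i < length \<pi> \<Longrightarrow> degree (length \<pi>) G i = \<pi> ! i"
    by (auto simp: realizes_def)
  define N where "N = length \<pi>"
  \<comment> \<open>The complement is taken with reversed vertex order because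
    \<open>compl_seq\<close> reverses the sequence.\<close>
  define C where "C = (\<lambda>i j. i < N \<and> j < N \<and> i \<noteq> j \<and> \<not> G (N - 1 - i) (N - 1 - j))"
  have C: "is_graph N C"
    using is_graphD(4)[OF G] by (auto simp: is_graph_def C_def)
  have "degree N C i = N - 1 - \<pi> ! (N - 1 - i)" if i: "i < N" for i
  proof -
    let ?i = "N - 1 - i"
    have "{j. C i j} = (\<lambda>j. N - 1 - j) ` ({..<N} - insert ?i {j. G ?i j})" (is "?L = ?f ` ?R")
    proof
      show "?L \<subseteq> ?f ` ?R"
      proof
        fix j assume "j \<in> ?L"
        then have "j = ?f (?f j)" "?f j \<in> ?R" by (auto simp: C_def)
        then show "j \<in> ?f ` ?R" by blast
      qed
      show "?f ` ?R \<subseteq> ?L" using i by (auto simp: C_def)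
    qed
    moreover have "inj_on ?f ?R" by (auto simp: inj_on_def)
    ultimately have "degree N C i = card ?R" by (simp add: degree_eq_card[OF C] card_image)
    also have "\<dots> = card {..<N} - card (insert ?i {j. G ?i j})"
      using i is_graphD(2)[OF G] finite_neighbours[OF G] by (intro card_Diff_subset) (auto simp: N_def)
    also have "\<dots> = N - 1 - \<pi> ! ?i"
      using i deg[of ?i] is_graphD(3)[OF G, of ?i] finite_neighbours[OF G, of ?i]
      by (simp add: degree_eq_card[OF G] N_def)
    finally show ?thesis .
  qed
  then have "realizes C (compl_seq \<pi>)"
    using C by (auto simp: realizes_def N_def compl_seq_def rev_nth)
  then show ?thesis by (auto simp: graphic_def)
qed

text \<open>Containing a star depends only on the largest degree, so all realizations of the
  complementary sequence agree.\<close>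

lemma potentially_star_compl_seq_iff:
  assumes "graphic \<pi>" "\<pi> \<noteq> []"
  shows "potentially_graphic (star k) (compl_seq \<pi>) \<longleftrightarrow> (\<exists>d\<in>set \<pi>. k \<le> length \<pi> - 1 - d)"
proof -
  let ?\<rho> = "compl_seq \<pi>"
  have "contains_subgraph (length ?\<rho>) G (star k) \<longleftrightarrow> (\<exists>d\<in>set ?\<rho>. k \<le> d)"
    if "realizes G ?\<rho>" for G
    using that assms(2) contains_star_iff[of "length \<pi>" G k]
    by (auto simp: realizes_def set_conv_nth)
  then show ?thesis
    using graphic_compl_seq[OF assms(1)]
    by (auto simp: potentially_graphic_def graphic_def set_compl_seq)
qed

lemma potentially_complete_graph:
  assumes "graphic \<pi>" "sorted_wrt (\<ge>) \<pi>" "2 * s \<le> length \<pi>" "\<And>d. d \<in> set \<pi> \<Longrightarrow> s \<le> d + 1"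
  shows "potentially_graphic (complete_graph s) \<pi>"
proof -
  obtain F where F: "realizes F \<pi>" using assms(1) by (auto simp: graphic_def)
  interpret clique_problem "length \<pi>" s "(!) \<pi>" F
  proof
    show "\<pi> ! j \<le> \<pi> ! i" if "i \<le> j" "j < length \<pi>" for i j
      using sorted_wrt_nth_less[OF assms(2), of i j] that by (cases "i = j") auto
  qed (use F assms in \<open>auto simp: realizes_def\<close>)
  obtain H where H: "is_graph (length \<pi>) H" "\<And>i. i < length \<pi> \<Longrightarrow> degree (length \<pi>) H i = \<pi> ! i"
    "\<And>i j. i < s \<Longrightarrow> j < s \<Longrightarrow> i \<noteq> j \<Longrightarrow> H i j"
    using ex_realization_with_clique by blast
  have "contains_subgraph (length \<pi>) H (complete_graph s)"
    unfolding contains_subgraph_def complete_graph_def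
    by (intro exI[of _ id]) (use H(3) assms(3) in auto)
  then show ?thesis using H(1,2) by (auto simp: potentially_graphic_def realizes_def)
qed

section \<open>Sequences for the lower bound\<close>

text \<open>The extremal example is the join of a complete graph on s - 2 vertices with an edgeless graph:
  in every realization only s - 2 vertices have degree at least s - 1.\<close>

lemma split_counterexample:
  assumes "s \<ge> 2" "t \<ge> 2" "0 < N" "N + 3 \<le> t + s"
  obtains \<pi> where "length \<pi> = N" "sorted_wrt (\<ge>) \<pi>" "graphic \<pi>"
    "\<not> potentially_graphic (complete_graph s) \<pi>"
    "\<not> potentially_graphic (star (t - 1)) (compl_seq \<pi>)"
proof -
  define \<pi> where "\<pi> = map (\<lambda>i. if i < s - 2 then N - 1 else s - 2) [0..<N]"
  have len: "length \<pi> = N" by (simp add: \<pi>_def)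
  have nth: "\<pi> ! i = (if i < s - 2 then N - 1 else s - 2)" if "i < N" for i
    using that by (simp add: \<pi>_def)
  have "sorted_wrt (\<ge>) \<pi>"
    using nth by (auto simp: sorted_wrt_iff_nth_less len)
  moreover have graphic: "graphic \<pi>"
  proof -
    let ?G = "\<lambda>i j. i < N \<and> j < N \<and> i \<noteq> j \<and> (i < s - 2 \<or> j < s - 2)"
    have G: "is_graph N ?G" by (auto simp: is_graph_def)
    have "degree N ?G i = \<pi> ! i" if i: "i < N" for i
    proof (cases "i < s - 2")
      case True
      then have "{j. ?G i j} = {..<N} - {i}" using i by auto
      then show ?thesis using True i by (simp add: degree_eq_card[OF G] nth)
    next
      case False
      then have "{j. ?G i j} = {..<s - 2}" using i by auto
      then show ?thesis using False i by (simp add: degree_eq_card[OF G] nth)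
    qed
    then show ?thesis using G by (auto simp: graphic_def realizes_def len)
  qed
  moreover have "\<not> potentially_graphic (complete_graph s) \<pi>"
  proof
    assume "potentially_graphic (complete_graph s) \<pi>"
    then obtain G where G: "is_graph N G" "\<And>i. i < N \<Longrightarrow> degree N G i = \<pi> ! i"
      and "contains_subgraph N G (complete_graph s)"
      by (auto simp: potentially_graphic_def realizes_def len)
    then obtain X where X: "X \<subseteq> {..<N}" "card X = s"
      "\<And>x y. x \<in> X \<Longrightarrow> y \<in> X \<Longrightarrow> x \<noteq> y \<Longrightarrow> G x y"
      using contains_complete_graphD by blast
    have "x < s - 2" if x: "x \<in> X" for x
    proof (rule ccontr)
      assume n: "\<not> x < s - 2"
      have "card (X - {x}) \<le> card {j. G x j}"
        using X(3) x by (intro card_mono finite_neighbours[OF G(1)]) auto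
      then have "s - 1 \<le> \<pi> ! x"
        using x X(1,2) G(2)[of x] by (auto simp: degree_eq_card[OF G(1)] card_Diff_singleton)
      then show False using x X(1) n nth[of x] assms(1) by auto
    qed
    then have "card X \<le> card {..<s - 2}" by (intro card_mono) auto
    then show False using X(2) assms(1) by simp
  qed
  \<comment> \<open>A term \<open>N - 1\<close> has complement 0 and a term \<open>s - 2\<close> has
    complement \<open>N + 1 - s\<close>, which is below \<open>t - 1\<close> by the bound on
    \<open>N\<close>.\<close>
  moreover have "\<not> potentially_graphic (star (t - 1)) (compl_seq \<pi>)"
    using graphic assms by (subst potentially_star_compl_seq_iff) (auto simp: \<pi>_def)
  ultimately show ?thesis using that len by blast
qed

text \<open>The extremal example is the complement of a cycle. The complement of any realization
  is 2-regular, and a 2-regular graph has at least twice as many vertices as an independent set.\<close>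

lemma cycle_counterexample:
  assumes "t \<ge> 4" "3 \<le> N" "N < 2 * s"
  obtains \<pi> where "length \<pi> = N" "sorted_wrt (\<ge>) \<pi>" "graphic \<pi>"
    "\<not> potentially_graphic (complete_graph s) \<pi>"
    "\<not> potentially_graphic (star (t - 1)) (compl_seq \<pi>)"
proof -
  define \<pi> where "\<pi> = replicate N (N - 3)"
  have len: "length \<pi> = N" by (simp add: \<pi>_def)
  have "sorted_wrt (\<ge>) \<pi>"
    by (auto simp: sorted_wrt_iff_nth_less \<pi>_def)
  moreover have graphic: "graphic \<pi>"
  proof -
    define C where "C i j \<longleftrightarrow> j = Suc i \<or> i = Suc j \<or> i = 0 \<and> j = N - 1 \<or> j = 0 \<and> i = N - 1" for i j
    let ?G = "\<lambda>i j. i < N \<and> j < N \<and> i \<noteq> j \<and> \<not> C i j"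
    have G: "is_graph N ?G" by (auto simp: is_graph_def C_def)
    have "degree N ?G i = N - 3" if i: "i < N" for i
    proof -
      \<comment> \<open>The vertices 0 and \<open>N - 1\<close> wrap around;
        \<open>3 \<le> N\<close> makes a vertex and its two cyclic neighbours distinct.\<close>
      consider "i = 0" | "i = N - 1" | "0 < i" "Suc i < N" using i by linarith
      then have "{..<N} - {j. ?G i j}
          = (if i = 0 then {0, 1, N - 1} else if i = N - 1 then {N - 1, N - 2, 0} else {i - 1, i, Suc i})"
        using assms(2) by cases (auto simp: C_def)
      moreover have "card (if i = 0 then {0, 1, N - 1} else if i = N - 1 then {N - 1, N - 2, 0}
          else {i - 1, i, Suc i}) = 3"
        using assms(2) by (simp add: card_insert_if) arith
      ultimately have "card ({..<N} - {j. ?G i j}) = 3" by (simp only:)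
      moreover have "card ({..<N} - {j. ?G i j}) = N - card {j. ?G i j}"
        by (subst card_Diff_subset) (auto intro: finite_subset[of _ "{..<N}"])
      moreover have "card {j. ?G i j} \<le> card {..<N}" by (intro card_mono) auto
      ultimately show ?thesis by (simp add: degree_eq_card[OF G])
    qed
    then show ?thesis using G by (auto simp: graphic_def realizes_def \<pi>_def)
  qed
  moreover have "\<not> potentially_graphic (complete_graph s) \<pi>"
  proof
    assume "potentially_graphic (complete_graph s) \<pi>"
    then obtain G where G: "is_graph N G" "\<And>i. i < N \<Longrightarrow> degree N G i = N - 3"
      and "contains_subgraph N G (complete_graph s)"
      by (auto simp: potentially_graphic_def realizes_def \<pi>_def)
    then obtain X where X: "X \<subseteq> {..<N}" "card X = s"
      "\<And>x y. x \<in> X \<Longrightarrow> y \<in> X \<Longrightarrow> x \<noteq> y \<Longrightarrow> G x y"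
      using contains_complete_graphD by blast
    define Y where "Y = {..<N} - X"
    have fin: "finite X" "finite Y" using X(1) by (auto simp: Y_def intro: finite_subset)
    \<comment> \<open>A vertex counts among its own nonneighbours, hence the total 3 rather than
      2.\<close>
    define m :: "nat \<Rightarrow> nat set \<Rightarrow> nat" where "m x S = (\<Sum>j\<in>S. of_bool (\<not> G x j))" for x S
    have m3: "m x X + m x Y = 3" if "x < N" for x
    proof -
      have "m x X + m x Y + degree N G x = (\<Sum>j<N. of_bool (\<not> G x j) + of_bool (G x j))"
        using sum.subset_diff[OF X(1), of "\<lambda>j. of_bool (\<not> G x j) :: nat"]
        unfolding sum.distrib degree_eq_sum by (simp add: m_def Y_def del: sum_of_bool_eq)
      also have "\<dots> = (\<Sum>j<N. 1)" by (intro sum.cong) auto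
      finally show ?thesis using G(2)[OF that] assms(2) by simp
    qed
    have self: "m x S = of_bool (\<not> G x x) + m x (S - {x})" if "x \<in> S" "finite S" for x S
      using that unfolding m_def by (simp add: sum.remove del: sum_of_bool_eq)
    have "m x Y = 2" if x: "x \<in> X" for x
    proof -
      have "m x (X - {x}) = 0" using X(3) x unfolding m_def by (intro sum.neutral) auto
      then show ?thesis
        using self[OF x fin(1)] m3[of x] x X(1) is_graphD(3)[OF G(1)] by auto
    qed
    \<comment> \<open>Double count the nonadjacent pairs between the clique \<open>X\<close> and the
      rest: two for each vertex of \<open>X\<close>, at most two for each of
      \<open>Y\<close>.\<close>
    then have "2 * s = (\<Sum>x\<in>X. m x Y)" using X(2) by simp
    also have "\<dots> = (\<Sum>y\<in>Y. \<Sum>x\<in>X. of_bool (\<not> G x y))"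
      unfolding m_def by (rule sum.swap)
    also have "\<dots> = (\<Sum>y\<in>Y. m y X)"
      unfolding m_def
      by (intro sum.cong refl arg_cong[where f = of_bool]) (use is_graphD(4)[OF G(1)] in blast)
    also have "\<dots> \<le> (\<Sum>y\<in>Y. 2)"
    proof (rule sum_mono)
      fix y assume y: "y \<in> Y"
      then show "m y X \<le> 2"
        using self[OF y fin(2)] m3[of y] is_graphD(3)[OF G(1)] by (auto simp: Y_def)
    qed
    also have "\<dots> = 2 * (N - s)"
      using X(1,2) fin by (simp add: Y_def card_Diff_subset)
    finally show False using assms(3) by linarith
  qed
  moreover have "\<not> potentially_graphic (star (t - 1)) (compl_seq \<pi>)"
    using graphic assms by (subst potentially_star_compl_seq_iff) (auto simp: \<pi>_def)
  ultimately show ?thesis using that len by blast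
qed

section \<open>Combining the upper and lower bounds\<close>

theorem theorem5:
  fixes s t :: nat
  assumes "s \<ge> 4" and "t \<ge> 4"
  shows "r_pot (complete_graph s) (star (t - 1)) = (if t < s + 2 then 2 * s else t + s - 2)"
proof -
  let ?M = "if t < s + 2 then 2 * s else t + s - 2"
  show ?thesis
    unfolding r_pot_def
  proof (rule Least_equality)
    show "\<forall>\<pi>. length \<pi> = ?M \<and> sorted_wrt (\<ge>) \<pi> \<and> graphic \<pi> \<longrightarrow>
        potentially_graphic (complete_graph s) \<pi> \<or> potentially_graphic (star (t - 1)) (compl_seq \<pi>)"
    proof (intro allI impI, elim conjE)
      fix \<pi> :: "nat list"
      assume \<pi>: "length \<pi> = ?M" "sorted_wrt (\<ge>) \<pi>" "graphic \<pi>"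
      have "\<pi> \<noteq> []" using \<pi>(1) assms by (auto split: if_splits)
      show "potentially_graphic (complete_graph s) \<pi> \<or> potentially_graphic (star (t - 1)) (compl_seq \<pi>)"
      proof (cases "\<exists>d\<in>set \<pi>. t - 1 \<le> length \<pi> - 1 - d")
        case True
        then show ?thesis using potentially_star_compl_seq_iff[OF \<pi>(3) \<open>\<pi> \<noteq> []\<close>] by blast
      next
        case False
        \<comment> \<open>Both values of \<open>?M\<close> are at least \<open>t + s - 2\<close>,
          and without a star every term exceeds \<open>?M - t\<close>.\<close>
        have "s \<le> d + 1" if "d \<in> set \<pi>" for d
        proof -
          have "length \<pi> - 1 - d < t - 1" using False that by (simp add: not_le)
          then show ?thesis using \<pi>(1) assms by (auto split: if_splits)
        qed
        moreover have "2 * s \<le> length \<pi>" using \<pi>(1) by (auto split: if_splits)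
        ultimately show ?thesis using potentially_complete_graph[OF \<pi>(3,2)] by blast
      qed
    qed
  next
    fix N
    assume N: "\<forall>\<pi>. length \<pi> = N \<and> sorted_wrt (\<ge>) \<pi> \<and> graphic \<pi> \<longrightarrow>
        potentially_graphic (complete_graph s) \<pi> \<or> potentially_graphic (star (t - 1)) (compl_seq \<pi>)"
    show "?M \<le> N"
    proof (rule ccontr)
      assume less: "\<not> ?M \<le> N"
      \<comment> \<open>For \<open>t \<ge> s + 2\<close> the split sequence covers every positive
        \<open>N\<close>; for smaller \<open>t\<close> it covers 1 and 2, and the cycle covers the
        rest.\<close>
      consider "N = 0" | "0 < N" "N + 3 \<le> t + s" | "3 \<le> N" "N < 2 * s"
        using less assms by (cases "t < s + 2"; force)
      then show False
      proof cases
        case 1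
        \<comment> \<open>The empty sequence is graphic, but neither pattern embeds into zero
          vertices.\<close>
        have "graphic []"
          by (auto simp: graphic_def realizes_def is_graph_def intro: exI[of _ "\<lambda>_ _. False"])
        then show False
          using 1 N[rule_format, of "[]"] assms
          by (auto simp: compl_seq_def potentially_graphic_def contains_subgraph_def
              complete_graph_def star_def)
      next
        case 2
        moreover have "s \<ge> 2" "t \<ge> 2" using assms by simp_all
        ultimately obtain \<pi> where "length \<pi> = N" "sorted_wrt (\<ge>) \<pi>" "graphic \<pi>"
          "\<not> potentially_graphic (complete_graph s) \<pi>"
          "\<not> potentially_graphic (star (t - 1)) (compl_seq \<pi>)"
          using split_counterexample by blast
        then show False using N by blast
      next
        case 3
        with assms(2) obtain \<pi> where "length \<pi> = N" "sorted_wrt (\<ge>) \<pi>" "graphic \<pi>"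
          "\<not> potentially_graphic (complete_graph s) \<pi>"
          "\<not> potentially_graphic (star (t - 1)) (compl_seq \<pi>)"
          using cycle_counterexample by blast
        then show False using N by blast
      qed
    qed
  qed
qed

end
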